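(* The effort $\nu^\star$ of the common Agent in the competitive model coincides with the effort $\nu^\star_{Pf}$ of the common Agent in the aggregated model if and only if the Agent is risk-neutral, that is, $R_A=0$.
   Context: Linear-quadratic model with two risk-neutral Principals and one Agent with exponential utility of risk aversion $R_A\ge0$ ($R_A=0$ being the risk-neutral Agent). $\Sigma\in\mathbb R^{2\times2}$ is an invertible matrix, $K=\mathrm{diag}(k_1,k_2)$ is an invertible diagonal matrix, $\gamma_1,\gamma_2\in[0,1]$, $\Gamma:=(1+\gamma_1-\gamma_2,\,1+\gamma_2-\gamma_1)^\top$. When the Agent exerts effort $\nu\in\mathbb R^2$, the output $X$ has dynamics $dX_t=K\nu_tdt+\Sigma dW_t$, and his cost is $\|\nu\|^2/2$. There is no discounting. Competitive model: Principal $i$ has terminal payoff $(1+\gamma_i)X^i_T-\gamma_iX^j_T-\xi^i$ ($j\ne i$) and pays $\xi^i=y^i+\int_0^T\alpha^i_sds+\int_0^T\beta^i_s\cdot dX_s$. The Agent's best response is $\nu^\star=K(\beta^1+\beta^2)$. At the Nash equilibrium $(\beta^{1,\star},\beta^{2,\star})$ of the Principals obtained from the system of HJB equations with the first order conditions $\beta^{i,\star}=\nabla_xv^i-K^{-2}R_A\Sigma\Sigma^\top(\beta^{1,\star}+\beta^{2,\star})$, where $v^i$ is the value function of Principal $i$ with $\nabla_xv^1=(1+\gamma_1,-\gamma_1)^\top$, $\nabla_xv^2=(-\gamma_2,1+\gamma_2)^\top$, the Agent's effort is $$\nu^\star=KM\Gamma,\qquad M=\big(I_2+2K^{-2}R_A\Sigma\Sigma^\top\big)^{-1}.$$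 Aggregated model: a single Principal offers one salary $\xi$, of the form $Y_0+\int_0^TZ_s\cdot dX_s+\int_0^T\big(\frac{R_A}2\|\Sigma^\top Z_s\|^2-\frac12\|KZ_s\|^2\big)ds$, and maximizes the expectation of $X_T\cdot\Gamma-\xi$ under the Agent's best response $KZ$. The optimal $Z$ is $Z^\star=M_a\Gamma$ and the Agent's effort is $$\nu^\star_{Pf}=KM_a\Gamma,\qquad M_a=\big(R_A\Sigma\Sigma^\top+K^2\big)^{-1}K^2.$$ *)

theory Defs
  imports "HOL-Probability.Probability"
begin

section \<open>Brownian motion and the Ito integral\<close>

text \<open>
  The index type of the filtration is \<open>real\<close>; only times \<open>t \<ge> 0\<close> matter.
\<close>

definition brownian_motion ::
  "'a measure \<Rightarrow> (real \<Rightarrow> 'a measure) \<Rightarrow> (real \<Rightarrow> 'a \<Rightarrow> real^'n) \<Rightarrow> bool" where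
  "brownian_motion M F W \<longleftrightarrow>
     prob_space M \<and>
     filtration (space M) F \<and> (\<forall>t. subalgebra M (F t)) \<and>
     (\<forall>t\<ge>0. W t \<in> borel_measurable (F t)) \<and>
     (AE \<omega> in M. W 0 \<omega> = 0) \<and>
     (AE \<omega> in M. continuous_on {0..} (\<lambda>t. W t \<omega>)) \<and>
     (\<forall>s t. 0 \<le> s \<and> s < t \<longrightarrow>
        prob_space.indep_set M (sets (F s))
          (sets (vimage_algebra (space M) (\<lambda>\<omega>. W t \<omega> - W s \<omega>) borel)) \<and>
        prob_space.indep_vars M (\<lambda>_. borel) (\<lambda>i \<omega>. (W t \<omega> - W s \<omega>) $ i) UNIV \<and>
        (\<forall>i. distributed M lborel (\<lambda>\<omega>. (W t \<omega> - W s \<omega>) $ i)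
               (normal_density 0 (sqrt (t - s)))))"

definition time_space :: "real \<Rightarrow> 'a measure \<Rightarrow> (real \<times> 'a) measure" where
  "time_space T M = restrict_space lborel {0..T} \<Otimes>\<^sub>M M"

definition progressive ::
  "(real \<Rightarrow> 'a measure) \<Rightarrow> real \<Rightarrow> (real \<Rightarrow> 'a \<Rightarrow> 'b::topological_space) \<Rightarrow> bool" where
  "progressive F T H \<longleftrightarrow>
     (\<forall>t\<in>{0..T}. (\<lambda>(s, \<omega>). H s \<omega>) \<in> borel_measurable (restrict_space borel {0..t} \<Otimes>\<^sub>M F t))"

definition square_integrable ::
  "'a measure \<Rightarrow> real \<Rightarrow> (real \<Rightarrow> 'a \<Rightarrow> 'b::real_normed_vector) \<Rightarrow> bool" where
  "square_integrable M T H \<longleftrightarrow> integrable (time_space T M) (\<lambda>(s, \<omega>). (norm (H s \<omega>))\<^sup>2)"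

definition simple_ito ::
  "'a measure \<Rightarrow> (real \<Rightarrow> 'a measure) \<Rightarrow> (real \<Rightarrow> 'a \<Rightarrow> real^'n) \<Rightarrow> real \<Rightarrow>
     (real \<Rightarrow> 'a \<Rightarrow> real^'n) \<Rightarrow> ('a \<Rightarrow> real) \<Rightarrow> bool" where
  "simple_ito M F W T H I \<longleftrightarrow>
     (\<exists>(m::nat) (\<tau> :: nat \<Rightarrow> real) (\<eta> :: nat \<Rightarrow> 'a \<Rightarrow> real^'n).
        0 \<le> \<tau> 0 \<and> \<tau> m \<le> T \<and> (\<forall>k<m. \<tau> k < \<tau> (Suc k)) \<and>
        (\<forall>k<m. \<eta> k \<in> borel_measurable (F (\<tau> k)) \<and> (\<exists>B. \<forall>\<omega>\<in>space M. norm (\<eta> k \<omega>) \<le> B)) \<and>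
        H = (\<lambda>s \<omega>. \<Sum>k<m. indicator {\<tau> k<..\<tau> (Suc k)} s *\<^sub>R \<eta> k \<omega>) \<and>
        I = (\<lambda>\<omega>. \<Sum>k<m. \<eta> k \<omega> \<bullet> (W (\<tau> (Suc k)) \<omega> - W (\<tau> k) \<omega>)))"

text \<open>
  \<open>ito_integral M F W T H I\<close> says that \<open>I\<close> is a version of the Ito integral of \<open>H \<bullet> dW\<close> over
  \<open>{0..T}\<close>, i.e. the \<open>L\<^sup>2\<close>-limit of the integrals of simple processes converging to \<open>H\<close>.
  It is a relation because the integral is determined only up to a null set.
\<close>

definition ito_integral ::
  "'a measure \<Rightarrow> (real \<Rightarrow> 'a measure) \<Rightarrow> (real \<Rightarrow> 'a \<Rightarrow> real^'n) \<Rightarrow> real \<Rightarrow>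
     (real \<Rightarrow> 'a \<Rightarrow> real^'n) \<Rightarrow> ('a \<Rightarrow> real) \<Rightarrow> bool" where
  "ito_integral M F W T H I \<longleftrightarrow>
     progressive F T H \<and> square_integrable M T H \<and> I \<in> borel_measurable M \<and>
     (\<exists>Hn In. (\<forall>n::nat. simple_ito M F W T (Hn n) (In n)) \<and>
        (\<lambda>n. \<integral>\<^sup>+ (s, \<omega>). ennreal ((norm (Hn n s \<omega> - H s \<omega>))\<^sup>2) \<partial>time_space T M) \<longlonglongrightarrow> 0 \<and>
        (\<lambda>n. \<integral>\<^sup>+ \<omega>. ennreal ((In n \<omega> - I \<omega>)\<^sup>2) \<partial>M) \<longlonglongrightarrow> 0)"


section \<open>The linear-quadratic model\<close>

definition diag2 :: "real \<Rightarrow> real \<Rightarrow> real^2^2" where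
  "diag2 k1 k2 = vector [vector [k1, 0], vector [0, k2]]"

definition Gam :: "real \<Rightarrow> real \<Rightarrow> real^2" where
  "Gam \<gamma>1 \<gamma>2 = vector [1 + \<gamma>1 - \<gamma>2, 1 + \<gamma>2 - \<gamma>1]"

text \<open>
  The Agent's best response to a contract whose sensitivity with respect to \<open>X\<close> is \<open>z\<close>: he
  maximizes \<open>z \<bullet> K \<nu> - \<parallel>\<nu>\<parallel>\<^sup>2 / 2\<close>, and \<open>K\<close> is diagonal. Against two Principals the sensitivity is
  the sum of the two contracts' sensitivities.
\<close>

definition best_response :: "real^2^2 \<Rightarrow> real^2 \<Rightarrow> real^2" where
  "best_response K z = K *v z"


subsection \<open>Competitive model\<close>

text \<open>
  The Principals' value functions are affine in \<open>x\<close>, with the gradients of the terminal payoffs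
  \<open>(1 + \<gamma>\<^sub>i) X\<^sup>i - \<gamma>\<^sub>i X\<^sup>j\<close>.
\<close>

definition grad_v1 :: "real \<Rightarrow> real^2" where
  "grad_v1 \<gamma>1 = vector [1 + \<gamma>1, - \<gamma>1]"

definition grad_v2 :: "real \<Rightarrow> real^2" where
  "grad_v2 \<gamma>2 = vector [- \<gamma>2, 1 + \<gamma>2]"

text \<open>
  Nash equilibrium of the Principals, given by the first order conditions in the system of
  HJB equations.
\<close>

definition nash_equilibrium ::
  "real \<Rightarrow> real^2^2 \<Rightarrow> real^2^2 \<Rightarrow> real \<Rightarrow> real \<Rightarrow> real^2 \<Rightarrow> real^2 \<Rightarrow> bool" where
  "nash_equilibrium R K S \<gamma>1 \<gamma>2 \<beta>1 \<beta>2 \<longleftrightarrow>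
     \<beta>1 = grad_v1 \<gamma>1 - (matrix_inv (K ** K) ** (R *\<^sub>R (S ** transpose S))) *v (\<beta>1 + \<beta>2) \<and>
     \<beta>2 = grad_v2 \<gamma>2 - (matrix_inv (K ** K) ** (R *\<^sub>R (S ** transpose S))) *v (\<beta>1 + \<beta>2)"

definition competitive_effort :: "real^2^2 \<Rightarrow> real^2 \<Rightarrow> real^2 \<Rightarrow> real^2" where
  "competitive_effort K \<beta>1 \<beta>2 = best_response K (\<beta>1 + \<beta>2)"


subsection \<open>Aggregated model\<close>

definition aggregated_effort :: "real^2^2 \<Rightarrow> (real \<Rightarrow> 'a \<Rightarrow> real^2) \<Rightarrow> real \<Rightarrow> 'a \<Rightarrow> real^2" where
  "aggregated_effort K Z t \<omega> = best_response K (Z t \<omega>)"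

definition output_process ::
  "real^2 \<Rightarrow> real^2^2 \<Rightarrow> real^2^2 \<Rightarrow> (real \<Rightarrow> 'a \<Rightarrow> real^2) \<Rightarrow> (real \<Rightarrow> 'a \<Rightarrow> real^2) \<Rightarrow>
     real \<Rightarrow> 'a \<Rightarrow> real^2" where
  "output_process x0 K S W \<nu> t \<omega> = x0 + (LINT s:{0..t}|lborel. K *v \<nu> s \<omega>) + S *v W t \<omega>"

text \<open>
  \<open>salary M F W T Y0 R K S Z \<xi>\<close>: under the Agent's best response \<open>\<nu> = K Z\<close>, the random variable
  \<open>\<xi>\<close> equals
  \<open>Y0 + \<integral> Z \<bullet> dX + \<integral> (R/2 \<parallel>S\<^sup>T Z\<parallel>\<^sup>2 - 1/2 \<parallel>K Z\<parallel>\<^sup>2) ds\<close>, where, since \<open>dX = K \<nu> ds + S dW\<close>,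
  the integral \<open>\<integral> Z \<bullet> dX\<close> is \<open>\<integral> Z \<bullet> K \<nu> ds + \<integral> S\<^sup>T Z \<bullet> dW\<close>.
\<close>

definition salary ::
  "'a measure \<Rightarrow> (real \<Rightarrow> 'a measure) \<Rightarrow> (real \<Rightarrow> 'a \<Rightarrow> real^2) \<Rightarrow> real \<Rightarrow> real \<Rightarrow> real \<Rightarrow>
     real^2^2 \<Rightarrow> real^2^2 \<Rightarrow> (real \<Rightarrow> 'a \<Rightarrow> real^2) \<Rightarrow> ('a \<Rightarrow> real) \<Rightarrow> bool" where
  "salary M F W T Y0 R K S Z \<xi> \<longleftrightarrow>
     (\<exists>I. ito_integral M F W T (\<lambda>s \<omega>. transpose S *v Z s \<omega>) I \<and>
        \<xi> = (\<lambda>\<omega>. Y0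
               + ((LINT s:{0..T}|lborel. Z s \<omega> \<bullet> (K *v aggregated_effort K Z s \<omega>)) + I \<omega>)
               + (LINT s:{0..T}|lborel.
                    R / 2 * (norm (transpose S *v Z s \<omega>))\<^sup>2 - 1 / 2 * (norm (K *v Z s \<omega>))\<^sup>2)))"

definition admissible ::
  "'a measure \<Rightarrow> (real \<Rightarrow> 'a measure) \<Rightarrow> real \<Rightarrow> (real \<Rightarrow> 'a \<Rightarrow> real^2) \<Rightarrow> bool" where
  "admissible M F T Z \<longleftrightarrow> progressive F T Z \<and> square_integrable M T Z"

definition aggregated_payoff ::
  "'a measure \<Rightarrow> (real \<Rightarrow> 'a \<Rightarrow> real^2) \<Rightarrow> real \<Rightarrow> real^2 \<Rightarrow> real^2^2 \<Rightarrow> real^2^2 \<Rightarrow>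
     real \<Rightarrow> real \<Rightarrow> (real \<Rightarrow> 'a \<Rightarrow> real^2) \<Rightarrow> ('a \<Rightarrow> real) \<Rightarrow> real" where
  "aggregated_payoff M W T x0 K S \<gamma>1 \<gamma>2 Z \<xi> =
     (\<integral>\<omega>. output_process x0 K S W (aggregated_effort K Z) T \<omega> \<bullet> Gam \<gamma>1 \<gamma>2 - \<xi> \<omega> \<partial>M)"

text \<open>
  The constant \<open>Y0\<close> is fixed (by the Agent's participation constraint), so that the Principal
  optimizes over \<open>Z\<close>. The payoff does not depend on the chosen version of the salary.
\<close>

definition aggregated_optimal ::
  "'a measure \<Rightarrow> (real \<Rightarrow> 'a measure) \<Rightarrow> (real \<Rightarrow> 'a \<Rightarrow> real^2) \<Rightarrow> real \<Rightarrow> real^2 \<Rightarrow> real \<Rightarrow> real \<Rightarrow>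
     real^2^2 \<Rightarrow> real^2^2 \<Rightarrow> real \<Rightarrow> real \<Rightarrow> (real \<Rightarrow> 'a \<Rightarrow> real^2) \<Rightarrow> bool" where
  "aggregated_optimal M F W T x0 Y0 R K S \<gamma>1 \<gamma>2 Z \<longleftrightarrow>
     admissible M F T Z \<and>
     (\<exists>\<xi>. salary M F W T Y0 R K S Z \<xi> \<and>
        (\<forall>Z' \<xi>'. admissible M F T Z' \<and> salary M F W T Y0 R K S Z' \<xi>' \<longrightarrow>
           aggregated_payoff M W T x0 K S \<gamma>1 \<gamma>2 Z' \<xi>' \<le> aggregated_payoff M W T x0 K S \<gamma>1 \<gamma>2 Z \<xi>))"

end

theory Submission
  imports Defs
begin

text \<open>
  Both efforts are images under \<open>K\<close> of solutions of two linear systems with the same right-hand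
  side. With \<open>g = \<Gamma>\<close>, adding up the Principals' first order conditions shows that the total
  sensitivity \<open>b = \<beta>1 + \<beta>2\<close> solves \<open>(K\<^sup>2 + 2 R S S\<^sup>T) b = K\<^sup>2 g\<close>, whereas the aggregated
  Principal uses the solution \<open>z\<close> of \<open>(K\<^sup>2 + R S S\<^sup>T) z = K\<^sup>2 g\<close>. The factor 2 arises because
  each Principal bears the premium for the total risk of the Agent. If \<open>b = z\<close>, subtraction gives
  \<open>R S S\<^sup>T z = 0\<close>; so \<open>R = 0\<close> unless \<open>z = 0\<close>, and \<open>z = 0\<close> would force \<open>g = 0\<close>, which is impossible
  since the two entries of \<open>\<Gamma>\<close> add up to 2. If \<open>R = 0\<close>, both systems read \<open>K\<^sup>2 b = K\<^sup>2 g\<close>. This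
  is \<open>efforts_agree_iff_risk_neutral\<close>.

  The aggregated control \<open>Z\<close> is only known to be optimal among square integrable processes, so it
  has to be shown that \<open>K Z\<close> is almost everywhere equal to \<open>K z\<close>. Since the Ito integral in the salary
  has mean zero (\<open>ito_integral_mean_zero\<close>), Fubini's theorem turns the payoff into a constant plus the
  integral over time and chance of a concave quadratic function of the current control
  (\<open>aggregated_payoff_eq\<close>). At its maximizer \<open>z\<close> this function exceeds its value at \<open>Z\<close> by at least
  \<open>\<parallel>K Z - K z\<parallel>\<^sup>2 / 2\<close> (\<open>running_payoff_gap\<close>). The constant control \<open>z\<close> is admissible, and optimality
  of \<open>Z\<close> against it makes the integral of this nonnegative excess vanish
  (\<open>aggregated_optimal_effort\<close>).
\<close>

section \<open>Zero mean of the Ito integral\<close>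

lemma brownian_increment_mean_zero:
  fixes W :: "real \<Rightarrow> 'a \<Rightarrow> real^'n"
  assumes bm: "brownian_motion M F W" and st: "0 \<le> s" "s < t"
  shows "has_bochner_integral M (\<lambda>\<omega>. (W t \<omega> - W s \<omega>) $ i) 0"
proof -
  interpret prob_space M using bm by (simp add: brownian_motion_def)
  have D: "distributed M lborel (\<lambda>\<omega>. (W t \<omega> - W s \<omega>) $ i) (normal_density 0 (sqrt (t - s)))"
    using bm st by (simp add: brownian_motion_def)
  have pos: "0 < sqrt (t - s)" using st by simp
  have "integrable M (\<lambda>\<omega>. (W t \<omega> - W s \<omega>) $ i)"
    using distributed_integrable[OF D, of "\<lambda>x. x"] integrable_normal_moment_nz_1[OF pos]
    by simp
  moreover have "expectation (\<lambda>\<omega>. (W t \<omega> - W s \<omega>) $ i) = 0"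
    using distributed_integral[OF D, of "\<lambda>x. x"] integral_normal_moment_nz_1[OF pos]
    by simp
  ultimately show ?thesis by (simp add: has_bochner_integral_iff)
qed

text \<open>
  A coefficient known at time \<open>s\<close> is independent of the later increment, so that the expectation of
  their product factorizes, coordinate by coordinate, into zero. Boundedness provides the
  integrability of the coefficient.
\<close>

lemma bounded_inner_brownian_increment_mean_zero:
  fixes W :: "real \<Rightarrow> 'a \<Rightarrow> real^'n"
  assumes bm: "brownian_motion M F W" and st: "0 \<le> s" "s < t"
    and \<eta>: "\<eta> \<in> borel_measurable (F s)" and B: "\<forall>\<omega>\<in>space M. norm (\<eta> \<omega>) \<le> B"
  shows "has_bochner_integral M (\<lambda>\<omega>. \<eta> \<omega> \<bullet> (W t \<omega> - W s \<omega>)) 0"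
proof -
  interpret prob_space M using bm by (simp add: brownian_motion_def)
  let ?D = "\<lambda>\<omega>. W t \<omega> - W s \<omega>"
  have sub: "subalgebra M (F s)" using bm by (simp add: brownian_motion_def)
  have sp: "space (F s) = space M" using sub by (simp add: subalgebra_def)
  have ind: "indep_set (sets (F s)) (sets (vimage_algebra (space M) ?D borel))"
    using bm st by (simp add: brownian_motion_def)
  have "has_bochner_integral M (\<lambda>\<omega>. \<eta> \<omega> $ i * ?D \<omega> $ i) 0" for i
  proof -
    note inc = brownian_increment_mean_zero[OF bm st, of i]
    have \<eta>i: "(\<lambda>\<omega>. \<eta> \<omega> $ i) \<in> borel_measurable (F s)"
      using \<eta> by (rule measurable_compose) simp
    have \<eta>M: "(\<lambda>\<omega>. \<eta> \<omega> $ i) \<in> borel_measurable M"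
      by (rule measurable_from_subalg[OF sub \<eta>i])
    have DM: "(\<lambda>\<omega>. ?D \<omega> $ i) \<in> borel_measurable M"
      using inc by (rule borel_measurable_has_bochner_integral)
    have gen\<eta>: "sigma_sets (space M) {(\<lambda>\<omega>. \<eta> \<omega> $ i) -` A \<inter> space M | A. A \<in> sets borel} \<subseteq> sets (F s)"
      unfolding sp[symmetric]
      by (rule sets.sigma_sets_subset) (use \<eta>i in \<open>auto simp: measurable_def\<close>)
    have "{(\<lambda>\<omega>. ?D \<omega> $ i) -` A \<inter> space M | A. A \<in> sets borel}
        \<subseteq> sets (vimage_algebra (space M) ?D borel)"
    proof (clarify)
      fix A :: "real set" assume A: "A \<in> sets borel"
      have "(\<lambda>x::real^'n. x $ i) -` A \<inter> space borel \<in> sets borel"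
        by (rule measurable_sets[OF _ A]) simp
      moreover have "(\<lambda>\<omega>. ?D \<omega> $ i) -` A \<inter> space M = ?D -` ((\<lambda>x. x $ i) -` A) \<inter> space M"
        by auto
      ultimately show "(\<lambda>\<omega>. ?D \<omega> $ i) -` A \<inter> space M \<in> sets (vimage_algebra (space M) ?D borel)"
        by (simp add: in_vimage_algebra)
    qed
    from sets.sigma_sets_subset[OF this]
    have genD: "sigma_sets (space M) {(\<lambda>\<omega>. ?D \<omega> $ i) -` A \<inter> space M | A. A \<in> sets borel}
        \<subseteq> sets (vimage_algebra (space M) ?D borel)" by simp
    have "indep_var borel (\<lambda>\<omega>. \<eta> \<omega> $ i) borel (\<lambda>\<omega>. ?D \<omega> $ i)"
      unfolding indep_var_eq
    proof (intro conjI \<eta>M DM)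
      show "indep_set (sigma_sets (space M) {(\<lambda>\<omega>. \<eta> \<omega> $ i) -` A \<inter> space M | A. A \<in> sets borel})
         (sigma_sets (space M) {(\<lambda>\<omega>. ?D \<omega> $ i) -` A \<inter> space M | A. A \<in> sets borel})"
        using ind gen\<eta> genD unfolding indep_sets2_eq by blast
    qed
    moreover have "integrable M (\<lambda>\<omega>. \<eta> \<omega> $ i)"
    proof (rule integrable_const_bound[where B = B, OF _ \<eta>M], rule AE_I2)
      fix \<omega> assume "\<omega> \<in> space M"
      then show "norm (\<eta> \<omega> $ i) \<le> B"
        using B component_le_norm_cart[of "\<eta> \<omega>" i] by (auto intro: order_trans)
    qed
    moreover have "integrable M (\<lambda>\<omega>. ?D \<omega> $ i)" "expectation (\<lambda>\<omega>. ?D \<omega> $ i) = 0"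
      using inc by (simp_all add: has_bochner_integral_iff)
    ultimately show ?thesis
      using indep_var_integrable[of "\<lambda>\<omega>. \<eta> \<omega> $ i" "\<lambda>\<omega>. ?D \<omega> $ i"]
        indep_var_lebesgue_integral[of "\<lambda>\<omega>. \<eta> \<omega> $ i" "\<lambda>\<omega>. ?D \<omega> $ i"]
      by (simp add: has_bochner_integral_iff)
  qed
  then have "has_bochner_integral M (\<lambda>\<omega>. \<Sum>i\<in>UNIV. \<eta> \<omega> $ i * ?D \<omega> $ i) (\<Sum>i\<in>(UNIV::'n set). 0)"
    by (intro has_bochner_integral_sum)
  then show ?thesis by (simp add: inner_vec_def)
qed

lemma simple_ito_mean_zero:
  fixes W :: "real \<Rightarrow> 'a \<Rightarrow> real^'n"
  assumes bm: "brownian_motion M F W" and I: "simple_ito M F W T H I"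
  shows "has_bochner_integral M I 0"
proof -
  obtain m \<tau> \<eta> where \<tau>: "0 \<le> \<tau> 0" "\<forall>k<m. \<tau> k < \<tau> (Suc k)"
    and \<eta>: "\<forall>k<m. \<eta> k \<in> borel_measurable (F (\<tau> k)) \<and> (\<exists>B. \<forall>\<omega>\<in>space M. norm (\<eta> k \<omega>) \<le> B)"
    and I_eq: "I = (\<lambda>\<omega>. \<Sum>k<m. \<eta> k \<omega> \<bullet> (W (\<tau> (Suc k)) \<omega> - W (\<tau> k) \<omega>))"
    using I unfolding simple_ito_def by auto
  have pos: "0 \<le> \<tau> k" if "k \<le> m" for k
    using that
  proof (induction k)
    case (Suc k)
    then have "\<tau> k < \<tau> (Suc k)" using \<tau>(2) by simp
    with Suc show ?case by simp
  qed (use \<tau>(1) in simp)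
  have "has_bochner_integral M (\<lambda>\<omega>. \<eta> k \<omega> \<bullet> (W (\<tau> (Suc k)) \<omega> - W (\<tau> k) \<omega>)) 0" if k: "k < m" for k
  proof -
    obtain B where "\<forall>\<omega>\<in>space M. norm (\<eta> k \<omega>) \<le> B" using \<eta> k by blast
    then show ?thesis
      using \<eta> k \<tau>(2) pos[of k] bounded_inner_brownian_increment_mean_zero[OF bm, of "\<tau> k" "\<tau> (Suc k)" "\<eta> k"]
      by simp
  qed
  then have "has_bochner_integral M I (\<Sum>k<m. 0)"
    unfolding I_eq by (intro has_bochner_integral_sum) simp
  then show ?thesis by simp
qed

text \<open>
  By Jensen's inequality \<open>(E (X n) - E Y)\<^sup>2 \<le> E (X n - Y)\<^sup>2\<close>. Integrability of \<open>Y\<close> is part of the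
  claim: it holds because \<open>X n - Y\<close> is square integrable as soon as the \<open>L\<^sup>2\<close> distance is finite.
\<close>

lemma (in prob_space) L2_limit_mean_zero:
  fixes X :: "nat \<Rightarrow> 'a \<Rightarrow> real"
  assumes X: "\<And>n. has_bochner_integral M (X n) 0" and Y[measurable]: "Y \<in> borel_measurable M"
    and lim: "(\<lambda>n. \<integral>\<^sup>+ \<omega>. ennreal ((X n \<omega> - Y \<omega>)\<^sup>2) \<partial>M) \<longlonglongrightarrow> 0"
  shows "has_bochner_integral M Y 0"
proof -
  have [measurable]: "X n \<in> borel_measurable M" for n
    using X[of n] by (rule borel_measurable_has_bochner_integral)
  have Xi: "integrable M (X n)" "expectation (X n) = 0" for n
    using X[of n] by (simp_all add: has_bochner_integral_iff)
  have sq: "integrable M Y \<and> ennreal ((expectation Y)\<^sup>2) \<le> (\<integral>\<^sup>+ \<omega>. ennreal ((X n \<omega> - Y \<omega>)\<^sup>2) \<partial>M)"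
    if fin: "(\<integral>\<^sup>+ \<omega>. ennreal ((X n \<omega> - Y \<omega>)\<^sup>2) \<partial>M) < 1" for n
  proof -
    let ?D = "\<lambda>\<omega>. X n \<omega> - Y \<omega>"
    have D2: "integrable M (\<lambda>\<omega>. (?D \<omega>)\<^sup>2)"
      by (rule integrableI_bounded) (use fin in \<open>auto intro: less_trans\<close>)
    have D: "integrable M ?D"
      by (rule square_integrable_imp_integrable[OF _ D2]) measurable
    have "integrable M (\<lambda>\<omega>. X n \<omega> - ?D \<omega>)" by (rule Bochner_Integration.integrable_diff[OF Xi(1) D])
    then have Yi: "integrable M Y" by simp
    have "expectation ?D = - expectation Y" using Xi Yi by simp
    moreover have "(expectation ?D)\<^sup>2 \<le> expectation (\<lambda>\<omega>. (?D \<omega>)\<^sup>2)"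
      using variance_positive[of ?D] variance_eq[OF D D2] by simp
    ultimately have "(expectation Y)\<^sup>2 \<le> expectation (\<lambda>\<omega>. (?D \<omega>)\<^sup>2)" by simp
    then show ?thesis
      using Yi nn_integral_eq_integral[OF D2] by (simp add: ennreal_leI)
  qed
  have ev: "eventually (\<lambda>n. (\<integral>\<^sup>+ \<omega>. ennreal ((X n \<omega> - Y \<omega>)\<^sup>2) \<partial>M) < 1) sequentially"
    by (rule order_tendstoD(2)[OF lim]) simp
  then obtain n where "(\<integral>\<^sup>+ \<omega>. ennreal ((X n \<omega> - Y \<omega>)\<^sup>2) \<partial>M) < 1"
    using eventually_happens' sequentially_bot by blast
  then have Yi: "integrable M Y" using sq by blast
  have "ennreal ((expectation Y)\<^sup>2) \<le> 0"
    by (rule tendsto_lowerbound[OF lim]) (use ev in \<open>auto elim!: eventually_mono dest: sq\<close>)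
  then have "expectation Y = 0" by (simp add: ennreal_eq_0_iff)
  with Yi show ?thesis by (simp add: has_bochner_integral_iff)
qed

lemma ito_integral_mean_zero:
  fixes W :: "real \<Rightarrow> 'a \<Rightarrow> real^'n"
  assumes bm: "brownian_motion M F W" and I: "ito_integral M F W T H I"
  shows "has_bochner_integral M I 0"
proof -
  interpret prob_space M using bm by (simp add: brownian_motion_def)
  obtain Hn In where "\<forall>n::nat. simple_ito M F W T (Hn n) (In n)"
    and "(\<lambda>n. \<integral>\<^sup>+ \<omega>. ennreal ((In n \<omega> - I \<omega>)\<^sup>2) \<partial>M) \<longlonglongrightarrow> 0"
    using I unfolding ito_integral_def by blast
  moreover have "I \<in> borel_measurable M" using I by (simp add: ito_integral_def)
  ultimately show ?thesis
    using L2_limit_mean_zero[of In I] simple_ito_mean_zero[OF bm] by blast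
qed

text \<open>
  The noise term of the output enters the payoff of every control in the same way; only its
  integrability matters, because it allows the constant to be split off.
\<close>

lemma brownian_integrable:
  fixes W :: "real \<Rightarrow> 'a \<Rightarrow> real^'n"
  assumes bm: "brownian_motion M F W" and t: "0 < t"
  shows "integrable M (\<lambda>\<omega>. W t \<omega> $ i)"
proof -
  have "W t \<in> borel_measurable M"
    using bm t measurable_from_subalg[of M "F t" "W t" borel] by (simp add: brownian_motion_def)
  then have Wt: "(\<lambda>\<omega>. W t \<omega> $ i) \<in> borel_measurable M"
    by (rule measurable_compose) simp
  have AE0: "AE \<omega> in M. W 0 \<omega> = 0" using bm by (simp add: brownian_motion_def)
  have "has_bochner_integral M (\<lambda>\<omega>. (W t \<omega> - W 0 \<omega>) $ i) 0"
    by (rule brownian_increment_mean_zero[OF bm]) (use t in auto)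
  then have "integrable M (\<lambda>\<omega>. (W t \<omega> - W 0 \<omega>) $ i)"
    by (simp add: has_bochner_integral_iff)
  then show ?thesis
    by (rule integrable_cong_AE_imp[OF _ Wt]) (use AE0 in \<open>auto elim: eventually_mono\<close>)
qed

section \<open>The payoff of the aggregated Principal\<close>

text \<open>
  The integrand left over once the mean-zero term has dropped out: output drift valued by \<open>g\<close>, minus
  the two time integrals of the salary, all under the best response \<open>K z\<close>. It is kept in the form of
  the contract rather than simplified, so that the three parts match those of the salary.
\<close>

definition running_payoff :: "real \<Rightarrow> real^'n^'n \<Rightarrow> real^'n^'n \<Rightarrow> real^'n \<Rightarrow> real^'n \<Rightarrow> real" where
  "running_payoff R K S g z =
     (K *v (K *v z)) \<bullet> g - z \<bullet> (K *v (K *v z))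
       - (R / 2 * (norm (transpose S *v z))\<^sup>2 - 1 / 2 * (norm (K *v z))\<^sup>2)"

lemma progressive_measurable_time_space:
  fixes Z :: "real \<Rightarrow> 'a \<Rightarrow> real^'n"
  assumes bm: "brownian_motion M F W" and T: "0 \<le> T" and Z: "progressive F T Z"
  shows "(\<lambda>(s, \<omega>). Z s \<omega>) \<in> borel_measurable (time_space T M)"
proof -
  have sub: "subalgebra M (F T)" using bm by (simp add: brownian_motion_def)
  have "(\<lambda>\<omega>. \<omega>) \<in> measurable M (F T)"
    by (rule measurable_from_subalg[OF sub]) simp
  moreover have "(\<lambda>s. s) \<in> measurable (restrict_space lborel {0..T}) (restrict_space borel {0..T})"
    by (rule measurable_ident_sets) (simp add: sets_restrict_space)
  ultimately have "(\<lambda>p. (fst p, snd p)) \<in>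
      measurable (time_space T M) (restrict_space borel {0..T} \<Otimes>\<^sub>M F T)"
    unfolding time_space_def
    by (intro measurable_Pair measurable_compose[OF measurable_fst] measurable_compose[OF measurable_snd])
  then show ?thesis
    using Z T measurable_compose[of "\<lambda>p. (fst p, snd p)" "time_space T M"
        "restrict_space borel {0..T} \<Otimes>\<^sub>M F T" "\<lambda>(s, \<omega>). Z s \<omega>" borel]
    by (simp add: progressive_def case_prod_beta)
qed

lemma time_space_finite:
  assumes "prob_space M" "0 \<le> T"
  shows "emeasure (time_space T M) (space (time_space T M)) = ennreal T"
    and "finite_measure (time_space T M)"
proof -
  interpret prob_space M by fact
  have "emeasure (time_space T M) ({0..T} \<times> space M) = emeasure (restrict_space lborel {0..T}) {0..T} * 1"
    unfolding time_space_def emeasure_space_1[symmetric]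
    by (rule emeasure_pair_measure_Times) (auto simp: sets_restrict_space)
  also have "\<dots> = ennreal T"
    using assms by (simp add: emeasure_restrict_space)
  finally show *: "emeasure (time_space T M) (space (time_space T M)) = ennreal T"
    by (simp add: time_space_def space_pair_measure space_restrict_space)
  show "finite_measure (time_space T M)"
    by (rule finite_measureI) (simp add: *)
qed

lemma integrable_matrix_quadratic:
  fixes Z :: "'b \<Rightarrow> real^'n" and A :: "real^'n^'m"
  assumes Z[measurable]: "Z \<in> borel_measurable N" and Z2: "integrable N (\<lambda>x. (norm (Z x))\<^sup>2)"
  shows "integrable N (\<lambda>x. (norm (A *v Z x))\<^sup>2)"
proof (rule Bochner_Integration.integrable_bound)
  let ?C = "onorm ((*v) A)"
  show "integrable N (\<lambda>x. ?C\<^sup>2 * (norm (Z x))\<^sup>2)" using Z2 by simp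
  have "(\<lambda>x. A *v Z x) \<in> borel_measurable N"
    using Z by (rule borel_measurable_continuous_on[rotated])
       (simp add: linear_continuous_on matrix_vector_mul_bounded_linear)
  then show "(\<lambda>x. (norm (A *v Z x))\<^sup>2) \<in> borel_measurable N" by measurable
  have "(norm (A *v z))\<^sup>2 \<le> ?C\<^sup>2 * (norm z)\<^sup>2" for z
    unfolding power_mult_distrib[symmetric]
    by (rule power_mono) (auto intro: onorm matrix_vector_mul_bounded_linear)
  then show "AE x in N. norm ((norm (A *v Z x))\<^sup>2) \<le> norm (?C\<^sup>2 * (norm (Z x))\<^sup>2)"
    by simp
qed

lemma (in finite_measure) integrable_of_square_norm:
  fixes Z :: "'a \<Rightarrow> real^'n"
  assumes Z[measurable]: "Z \<in> borel_measurable M" and Z2: "integrable M (\<lambda>x. (norm (Z x))\<^sup>2)"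
  shows "integrable M Z"
proof -
  have "integrable M (\<lambda>x. norm (Z x))"
    by (rule square_integrable_imp_integrable[OF _ Z2]) measurable
  then show ?thesis by (simp add: integrable_norm_iff)
qed

lemma inner_matrix_self_adjoint_square:
  fixes K :: "real^'n^'n"
  assumes "transpose K = K"
  shows "x \<bullet> (K *v (K *v y)) = (K *v x) \<bullet> (K *v y)"
  using dot_lmul_matrix[of x K "K *v y"] assms by (metis vector_transpose_matrix)

text \<open>
  On a finite measure space square integrability of the control gives integrability of each of the
  three parts, which is what permits splitting the integral and, later, interchanging the order of
  integration in each part separately.
\<close>

lemma integral_running_payoff:
  fixes Z :: "'b \<Rightarrow> real^'n"
  assumes sym: "transpose K = K" and N: "finite_measure N" and Z: "Z \<in> borel_measurable N"
    and Z2: "integrable N (\<lambda>x. (norm (Z x))\<^sup>2)"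
  shows "integrable N (\<lambda>x. K *v (K *v Z x))"
    and "integrable N (\<lambda>x. Z x \<bullet> (K *v (K *v Z x)))"
    and "integrable N (\<lambda>x. R / 2 * (norm (transpose S *v Z x))\<^sup>2 - 1 / 2 * (norm (K *v Z x))\<^sup>2)"
    and "integrable N (\<lambda>x. running_payoff R K S g (Z x))"
    and "(\<integral>x. running_payoff R K S g (Z x) \<partial>N) =
      (\<integral>x. K *v (K *v Z x) \<partial>N) \<bullet> g - (\<integral>x. Z x \<bullet> (K *v (K *v Z x)) \<partial>N)
       - (\<integral>x. R / 2 * (norm (transpose S *v Z x))\<^sup>2 - 1 / 2 * (norm (K *v Z x))\<^sup>2 \<partial>N)"
proof -
  have "integrable N Z" using finite_measure.integrable_of_square_norm[OF N Z Z2] .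
  then show lin: "integrable N (\<lambda>x. K *v (K *v Z x))"
    by (intro integrable_bounded_linear[OF matrix_vector_mul_bounded_linear])
  have "z \<bullet> (K *v (K *v z)) = (norm (K *v z))\<^sup>2" for z
    by (simp add: power2_norm_eq_inner inner_matrix_self_adjoint_square[OF sym])
  then show cost: "integrable N (\<lambda>x. Z x \<bullet> (K *v (K *v Z x)))"
    using integrable_matrix_quadratic[OF Z Z2, of K] by simp
  show drift: "integrable N (\<lambda>x. R / 2 * (norm (transpose S *v Z x))\<^sup>2 - 1 / 2 * (norm (K *v Z x))\<^sup>2)"
    by (intro Bochner_Integration.integrable_diff integrable_mult_right
        integrable_matrix_quadratic Z Z2)
  note lin_g = integrable_inner_left[OF lin, of g]
  show "integrable N (\<lambda>x. running_payoff R K S g (Z x))"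
    unfolding running_payoff_def
    by (intro Bochner_Integration.integrable_diff lin_g cost drift)
  show "(\<integral>x. running_payoff R K S g (Z x) \<partial>N) =
      (\<integral>x. K *v (K *v Z x) \<partial>N) \<bullet> g - (\<integral>x. Z x \<bullet> (K *v (K *v Z x)) \<partial>N)
       - (\<integral>x. R / 2 * (norm (transpose S *v Z x))\<^sup>2 - 1 / 2 * (norm (K *v Z x))\<^sup>2 \<partial>N)"
    unfolding running_payoff_def
      Bochner_Integration.integral_diff[OF Bochner_Integration.integrable_diff[OF lin_g cost] drift]
      Bochner_Integration.integral_diff[OF lin_g cost] integral_inner_left[OF lin] by (rule refl)
qed

text \<open>
  The salary is given through time integrals for each \<open>\<omega>\<close>. Interchanging expectation and time
  integral part by part makes every term an integral over the product space; there the parts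
  recombine to the running payoff. The remaining terms do not depend on \<open>Z\<close>.
\<close>

lemma aggregated_payoff_eq:
  fixes Z :: "real \<Rightarrow> 'a \<Rightarrow> real^2" and W :: "real \<Rightarrow> 'a \<Rightarrow> real^2"
  assumes bm: "brownian_motion M F W" and T: "0 < T" and sym: "transpose K = K"
    and Z: "admissible M F T Z" and \<xi>: "salary M F W T Y0 R K S Z \<xi>"
  shows "integrable (time_space T M) (\<lambda>p. running_payoff R K S (Gam \<gamma>1 \<gamma>2) (case_prod Z p))"
    and "aggregated_payoff M W T x0 K S \<gamma>1 \<gamma>2 Z \<xi> =
      x0 \<bullet> Gam \<gamma>1 \<gamma>2 - Y0 + (\<integral>\<omega>. (S *v W T \<omega>) \<bullet> Gam \<gamma>1 \<gamma>2 \<partial>M)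
        + (\<integral>p. running_payoff R K S (Gam \<gamma>1 \<gamma>2) (case_prod Z p) \<partial>time_space T M)"
proof -
  interpret prob_space M using bm by (simp add: brownian_motion_def)
  let ?g = "Gam \<gamma>1 \<gamma>2"
  let ?N = "restrict_space lborel {0..T}"
  interpret N: finite_measure ?N
    by (rule finite_measureI) (use T in \<open>simp add: emeasure_restrict_space space_restrict_space\<close>)
  interpret P: pair_sigma_finite ?N M ..
  have meas: "(\<lambda>p. case_prod Z p) \<in> borel_measurable (time_space T M)"
    by (rule progressive_measurable_time_space[OF bm])
      (use T Z in \<open>auto simp: admissible_def\<close>)
  have sq: "integrable (time_space T M) (\<lambda>p. (norm (case_prod Z p))\<^sup>2)"
    using Z by (simp add: admissible_def square_integrable_def case_prod_beta')
  note pieces = integral_running_payoff[OF sym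
      time_space_finite(2)[OF prob_space_axioms less_imp_le[OF T]] meas sq]
  show "integrable (time_space T M) (\<lambda>p. running_payoff R K S ?g (case_prod Z p))"
    by (rule pieces(4))
  obtain I where I: "ito_integral M F W T (\<lambda>s \<omega>. transpose S *v Z s \<omega>) I"
    and \<xi>_eq: "\<xi> = (\<lambda>\<omega>. Y0
         + ((LINT s:{0..T}|lborel. Z s \<omega> \<bullet> (K *v aggregated_effort K Z s \<omega>)) + I \<omega>)
         + (LINT s:{0..T}|lborel.
              R / 2 * (norm (transpose S *v Z s \<omega>))\<^sup>2 - 1 / 2 * (norm (K *v Z s \<omega>))\<^sup>2))"
    using \<xi> unfolding salary_def by blast
  have I0: "integrable M I" "expectation I = 0"
    using ito_integral_mean_zero[OF bm I] by (simp_all add: has_bochner_integral_iff)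
  have SW: "integrable M (\<lambda>\<omega>. (S *v W T \<omega>) \<bullet> ?g)"
    by (simp add: inner_vec_def matrix_vector_mult_def brownian_integrable[OF bm T])
  have fubini:
    "integrable M (\<lambda>\<omega>. LINT s:{0..T}|lborel. f (Z s \<omega>))"
    "expectation (\<lambda>\<omega>. LINT s:{0..T}|lborel. f (Z s \<omega>)) = (\<integral>p. f (case_prod Z p) \<partial>time_space T M)"
    if f: "integrable (time_space T M) (\<lambda>p. f (case_prod Z p))"
    for f :: "real^2 \<Rightarrow> 'c::{banach, second_countable_topology}"
  proof -
    have LINT: "(LINT s:{0..T}|lborel. f (Z s \<omega>)) = (\<integral>s. f (Z s \<omega>) \<partial>?N)" for \<omega>
      by (simp add: set_lebesgue_integral_def integral_restrict_space)
    have f': "integrable (?N \<Otimes>\<^sub>M M) (\<lambda>(s, \<omega>). f (Z s \<omega>))"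
      using f by (simp add: time_space_def case_prod_beta')
    show "integrable M (\<lambda>\<omega>. LINT s:{0..T}|lborel. f (Z s \<omega>))"
      unfolding LINT by (rule P.integrable_snd[OF f'])
    show "expectation (\<lambda>\<omega>. LINT s:{0..T}|lborel. f (Z s \<omega>)) = (\<integral>p. f (case_prod Z p) \<partial>time_space T M)"
      unfolding LINT P.integral_snd[OF f'] by (simp add: time_space_def case_prod_beta')
  qed
  note lin = fubini[OF pieces(1)] and cost = fubini[OF pieces(2)] and drift = fubini[OF pieces(3)[of R S]]
  let ?lin = "\<lambda>\<omega>. LINT s:{0..T}|lborel. K *v (K *v Z s \<omega>)"
  let ?cost = "\<lambda>\<omega>. LINT s:{0..T}|lborel. Z s \<omega> \<bullet> (K *v (K *v Z s \<omega>))"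
  let ?drift = "\<lambda>\<omega>. LINT s:{0..T}|lborel.
      R / 2 * (norm (transpose S *v Z s \<omega>))\<^sup>2 - 1 / 2 * (norm (K *v Z s \<omega>))\<^sup>2"
  have "aggregated_payoff M W T x0 K S \<gamma>1 \<gamma>2 Z \<xi> =
      expectation (\<lambda>\<omega>. (x0 \<bullet> ?g - Y0) + (S *v W T \<omega>) \<bullet> ?g + ?lin \<omega> \<bullet> ?g - ?cost \<omega> - I \<omega> - ?drift \<omega>)"
    unfolding aggregated_payoff_def
    by (rule Bochner_Integration.integral_cong)
      (simp_all add: output_process_def \<xi>_eq aggregated_effort_def best_response_def inner_add_left)
  also have "\<dots> = (x0 \<bullet> ?g - Y0) + expectation (\<lambda>\<omega>. (S *v W T \<omega>) \<bullet> ?g) + expectation ?lin \<bullet> ?g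
      - expectation ?cost - expectation I - expectation ?drift"
    using SW lin(1) cost(1) drift(1) I0(1) by (simp add: prob_space)
  finally show "aggregated_payoff M W T x0 K S \<gamma>1 \<gamma>2 Z \<xi> =
      x0 \<bullet> ?g - Y0 + (\<integral>\<omega>. (S *v W T \<omega>) \<bullet> ?g \<partial>M)
        + (\<integral>p. running_payoff R K S ?g (case_prod Z p) \<partial>time_space T M)"
    using lin(2) cost(2) drift(2) I0(2) pieces(5)[of R S ?g] by simp
qed

section \<open>The optimal control of the aggregated Principal\<close>

lemma inner_matrix_transpose_mult:
  fixes S :: "real^'n^'m"
  shows "x \<bullet> (S *v (transpose S *v y)) = (transpose S *v x) \<bullet> (transpose S *v y)"
  using dot_lmul_matrix[of x S "transpose S *v y"]
  by (simp add: transpose_matrix_vector)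

text \<open>
  The running payoff is the quadratic polynomial
  \<open>K w \<bullet> K g - \<parallel>K w\<parallel>\<^sup>2 / 2 - R \<parallel>S\<^sup>T w\<parallel>\<^sup>2 / 2\<close> in \<open>w\<close>, and the hypothesis says that its gradient vanishes
  at \<open>z0\<close>. Hence its Taylor expansion at \<open>z0\<close> consists of the second order term alone.
\<close>

lemma running_payoff_gap:
  fixes K S :: "real^'n^'n"
  assumes sym: "transpose K = K"
    and foc: "K *v (K *v z0) + R *\<^sub>R (S *v (transpose S *v z0)) = K *v (K *v g)"
  shows "running_payoff R K S g z0 - running_payoff R K S g z
    = ((norm (K *v z - K *v z0))\<^sup>2 + R * (norm (transpose S *v z - transpose S *v z0))\<^sup>2) / 2"
proof -
  \<comment> \<open>The first order condition tested against a direction eliminates \<open>g\<close> from the payoff.\<close>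
  have foc_w: "(K *v w) \<bullet> (K *v g) = (K *v w) \<bullet> (K *v z0) + R * ((transpose S *v w) \<bullet> (transpose S *v z0))" for w
    using arg_cong[OF foc, of "\<lambda>v. w \<bullet> v"]
    by (simp add: inner_add_right inner_matrix_self_adjoint_square[OF sym] inner_matrix_transpose_mult
        del: transpose_matrix_vector)
  have H: "running_payoff R K S g w = (K *v w) \<bullet> (K *v g) - (norm (K *v w))\<^sup>2 / 2
      - R / 2 * (norm (transpose S *v w))\<^sup>2" for w
    unfolding running_payoff_def inner_commute[of _ g] inner_matrix_self_adjoint_square[OF sym]
    by (simp add: power2_norm_eq_inner inner_commute)
  show ?thesis
    unfolding H foc_w power2_norm_eq_inner
    by (simp add: inner_diff_left inner_diff_right inner_commute field_simps)
qed

text \<open>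
  The operator \<open>K\<^sup>2 + R S S\<^sup>T\<close> is positive definite: its quadratic form is at least \<open>\<parallel>K z\<parallel>\<^sup>2\<close>, which
  vanishes only at 0. In finite dimension injectivity implies surjectivity.
\<close>

lemma first_order_condition_solvable:
  fixes K S :: "real^'n^'n"
  assumes sym: "transpose K = K" and K: "invertible K" and R: "0 \<le> R"
  obtains z0 where "K *v (K *v z0) + R *\<^sub>R (S *v (transpose S *v z0)) = b"
proof -
  let ?f = "\<lambda>z. K *v (K *v z) + R *\<^sub>R (S *v (transpose S *v z))"
  have lin: "linear ?f"
    by (rule linearI) (simp_all add: matrix_vector_right_distrib matrix_vector_mult_scaleR scaleR_add_right algebra_simps)
  have "z = 0" if z: "?f z = 0" for z
  proof -
    have "(norm (K *v z))\<^sup>2 + R * (norm (transpose S *v z))\<^sup>2 = z \<bullet> ?f z"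
      by (simp add: inner_add_right inner_matrix_self_adjoint_square[OF sym] inner_matrix_transpose_mult
          power2_norm_eq_inner del: transpose_matrix_vector)
    then have "(norm (K *v z))\<^sup>2 \<le> 0"
      using z R by (smt (verit) inner_zero_right mult_nonneg_nonneg zero_le_power2)
    then have "K *v z = K *v 0" by simp
    then show "z = 0" using inj_matrix_vector_mult[OF K] by (blast dest: injD)
  qed
  then have "inj ?f" using linear_injective_0[OF lin] by blast
  then have "surj ?f" by (rule linear_injective_imp_surjective[OF lin]) (rule refl)
  from surjD[OF this, of b] obtain z0 where "b = ?f z0" by (rule exE)
  then show thesis by (rule that[OF HOL.sym])
qed

text \<open>
  The competitor in the optimality comparison. Its salary exists because a constant is, outside time
  0, a simple process with the single step \<open>{0<..T}\<close>, whose integral is an increment of the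
  Brownian motion.
\<close>

lemma constant_control:
  fixes z :: "real^2" and W :: "real \<Rightarrow> 'a \<Rightarrow> real^2"
  assumes bm: "brownian_motion M F W" and T: "0 < T"
  shows "admissible M F T (\<lambda>_ _. z)"
    and "\<exists>\<xi>. salary M F W T Y0 R K S (\<lambda>_ _. z) \<xi>"
proof -
  interpret prob_space M using bm by (simp add: brownian_motion_def)
  have fin: "finite_measure (time_space T M)"
    using time_space_finite(2)[OF prob_space_axioms] T by simp
  interpret TS: finite_measure "time_space T M" by fact
  have prog: "progressive F T (\<lambda>_ _. c)" for c :: "real^2"
    by (simp add: progressive_def case_prod_beta')
  have sq: "square_integrable M T (\<lambda>_ _. c)" for c :: "real^2"
    by (simp add: square_integrable_def case_prod_beta')
  show "admissible M F T (\<lambda>_ _. z)" using prog sq by (simp add: admissible_def)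
  let ?c = "transpose S *v z"
  let ?I = "\<lambda>\<omega>. ?c \<bullet> (W T \<omega> - W 0 \<omega>)"
  let ?H = "\<lambda>(s::real) (\<omega>::'a). indicator {0<..T} s *\<^sub>R ?c"
  have simple: "simple_ito M F W T ?H ?I"
    unfolding simple_ito_def
    by (rule exI[of _ "Suc 0"], rule exI[of _ "\<lambda>k. if k = 0 then 0 else T"], rule exI[of _ "\<lambda>_ _. ?c"])
      (use T in auto)
  \<comment> \<open>The simple process vanishes at time 0 and agrees with the constant only after it.\<close>
  have "{0} \<times> space M \<in> null_sets (time_space T M)"
  proof (rule null_setsI)
    have 0: "{0} \<in> sets (restrict_space lborel {0..T})"
      using T by (auto simp: sets_restrict_space intro!: image_eqI[of _ _ "{0}"])
    then show "{0} \<times> space M \<in> sets (time_space T M)"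
      by (simp add: time_space_def)
    have "emeasure (restrict_space lborel {0..T}) {0} = 0"
      using T by (simp add: emeasure_restrict_space)
    then show "emeasure (time_space T M) ({0} \<times> space M) = 0"
      unfolding time_space_def by (simp add: emeasure_pair_measure_Times[OF 0])
  qed
  then have "AE p in time_space T M. p \<notin> {0} \<times> space M" by (rule AE_not_in)
  moreover have "AE p in time_space T M. p \<in> {0..T} \<times> space M"
    by (rule AE_I2) (auto simp: time_space_def space_pair_measure space_restrict_space)
  ultimately have "AE p in time_space T M. (case p of (s, \<omega>) \<Rightarrow> ennreal ((norm (?H s \<omega> - ?c))\<^sup>2)) = 0"
  proof eventually_elim
    case (elim p)
    then have "fst p \<in> {0<..T}" by auto
    then show ?case by (simp add: case_prod_beta')
  qed
  then have H0: "(\<integral>\<^sup>+ (s, \<omega>). ennreal ((norm (?H s \<omega> - ?c))\<^sup>2) \<partial>time_space T M) = 0"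
    using nn_integral_cong_AE[of _ "\<lambda>_. 0"] by fastforce
  have "has_bochner_integral M ?I 0"
    by (rule simple_ito_mean_zero[OF bm simple])
  then have "?I \<in> borel_measurable M" by (rule borel_measurable_has_bochner_integral)
  then have "ito_integral M F W T (\<lambda>_ _. ?c) ?I"
    unfolding ito_integral_def
    using prog sq simple H0
    by (intro conjI exI[of _ "\<lambda>_. ?H"] exI[of _ "\<lambda>_. ?I"]) auto
  then show "\<exists>\<xi>. salary M F W T Y0 R K S (\<lambda>_ _. z) \<xi>"
    unfolding salary_def by blast
qed

text \<open>
  The payoffs of \<open>Z\<close> and of the constant control \<open>z0\<close> differ by the integral of the gap in the
  running payoff. Optimality makes this integral nonpositive while the gap is nonnegative, so the gap
  vanishes almost everywhere.
\<close>

lemma aggregated_optimal_effort: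
  fixes W :: "real \<Rightarrow> 'a \<Rightarrow> real^2"
  assumes bm: "brownian_motion M F W" and T: "0 < T" and R: "0 \<le> R" and sym: "transpose K = K"
    and foc: "K *v (K *v z0) + R *\<^sub>R (S *v (transpose S *v z0)) = K *v (K *v Gam \<gamma>1 \<gamma>2)"
    and opt: "aggregated_optimal M F W T x0 Y0 R K S \<gamma>1 \<gamma>2 Z"
  shows "AE (t, \<omega>) in time_space T M. aggregated_effort K Z t \<omega> = K *v z0"
proof -
  let ?H = "running_payoff R K S (Gam \<gamma>1 \<gamma>2)"
  let ?D = "\<lambda>p. ?H z0 - ?H (case_prod Z p)"
  obtain \<xi>0 where \<xi>0: "salary M F W T Y0 R K S (\<lambda>_ _. z0) \<xi>0"
    using constant_control(2)[OF bm T] by blast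
  note adm0 = constant_control(1)[OF bm T, of z0]
  obtain \<xi> where Z: "admissible M F T Z" and \<xi>: "salary M F W T Y0 R K S Z \<xi>"
    and le: "aggregated_payoff M W T x0 K S \<gamma>1 \<gamma>2 (\<lambda>_ _. z0) \<xi>0
      \<le> aggregated_payoff M W T x0 K S \<gamma>1 \<gamma>2 Z \<xi>"
    using opt adm0 \<xi>0 unfolding aggregated_optimal_def by blast
  note pZ = aggregated_payoff_eq[OF bm T sym Z \<xi>, where ?\<gamma>1.0 = \<gamma>1 and ?\<gamma>2.0 = \<gamma>2]
  note p0 = aggregated_payoff_eq[OF bm T sym adm0 \<xi>0, where ?\<gamma>1.0 = \<gamma>1 and ?\<gamma>2.0 = \<gamma>2]
  have int0: "integrable (time_space T M) (\<lambda>_. ?H z0)"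
    using p0(1) by (simp add: case_prod_beta')
  have D: "integrable (time_space T M) ?D"
    by (intro Bochner_Integration.integrable_diff int0 pZ(1))
  have gap: "(norm (K *v case_prod Z p - K *v z0))\<^sup>2 / 2 \<le> ?D p" for p
    using R by (simp add: running_payoff_gap[OF sym foc])
  have D0: "0 \<le> ?D p" for p
    by (rule order_trans[OF _ gap]) simp
  have "(\<integral>p. ?D p \<partial>time_space T M) \<le> 0"
    using le p0(2)[where ?x0.0 = x0] pZ(2)[where ?x0.0 = x0] Bochner_Integration.integral_diff[OF int0 pZ(1)]
    by (simp add: case_prod_beta')
  moreover have "0 \<le> (\<integral>p. ?D p \<partial>time_space T M)"
    by (rule Bochner_Integration.integral_nonneg) (rule D0)
  ultimately have "AE p in time_space T M. ?D p = 0"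
    using integral_nonneg_eq_0_iff_AE[OF D] D0 by simp
  then have "AE p in time_space T M. K *v case_prod Z p = K *v z0"
  proof eventually_elim
    case (elim p)
    then have "(norm (K *v case_prod Z p - K *v z0))\<^sup>2 \<le> 0" using gap[of p] by simp
    then show ?case by simp
  qed
  then show ?thesis
    by (simp add: aggregated_effort_def best_response_def case_prod_beta')
qed

section \<open>Comparison of the efforts\<close>

text \<open>
  Both Principals subtract the same risk correction, which depends on the total sensitivity only.
  Adding the two conditions therefore doubles it, while the gradients of the value functions add up
  to \<open>\<Gamma>\<close>. Multiplying by \<open>K\<^sup>2\<close> clears the inverse.
\<close>

lemma nash_equilibrium_total_sensitivity:
  fixes K S :: "real^2^2"
  assumes K: "invertible K" and nash: "nash_equilibrium R K S \<gamma>1 \<gamma>2 \<beta>1 \<beta>2"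
  shows "K *v (K *v (\<beta>1 + \<beta>2)) + (2 * R) *\<^sub>R (S *v (transpose S *v (\<beta>1 + \<beta>2)))
    = K *v (K *v Gam \<gamma>1 \<gamma>2)"
proof -
  let ?B = "\<beta>1 + \<beta>2"
  let ?V = "R *\<^sub>R (S *v (transpose S *v ?B))"
  let ?P = "matrix_inv (K ** K)"
  have grad: "grad_v1 \<gamma>1 + grad_v2 \<gamma>2 = Gam \<gamma>1 \<gamma>2"
    by (simp add: grad_v1_def grad_v2_def Gam_def vec_eq_iff forall_2)
  have "(?P ** (R *\<^sub>R (S ** transpose S))) *v ?B = ?P *v ?V"
    by (simp add: matrix_vector_mul_assoc[symmetric] scaleR_matrix_vector_assoc[symmetric])
  then have "\<beta>1 = grad_v1 \<gamma>1 - ?P *v ?V" "\<beta>2 = grad_v2 \<gamma>2 - ?P *v ?V"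
    using nash unfolding nash_equilibrium_def by simp_all
  then have "?B = (grad_v1 \<gamma>1 - ?P *v ?V) + (grad_v2 \<gamma>2 - ?P *v ?V)"
    by (rule arg_cong2[where f = "(+)"])
  also have "\<dots> = Gam \<gamma>1 \<gamma>2 - 2 *\<^sub>R (?P *v ?V)"
    by (simp only: grad[symmetric] scaleR_2) simp
  finally have B: "?B = Gam \<gamma>1 \<gamma>2 - 2 *\<^sub>R (?P *v ?V)" .
  have "\<exists>A. (K ** K) ** A = mat 1 \<and> A ** (K ** K) = mat 1"
    using invertible_mult[OF K K] unfolding invertible_def .
  then have "(K ** K) ** ?P = mat 1"
    unfolding matrix_inv_def by (rule someI2_ex) simp
  then have "(K ** K) *v (?P *v v) = v" for v
    by (simp add: matrix_vector_mul_assoc)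
  then have "(K ** K) *v ?B = (K ** K) *v Gam \<gamma>1 \<gamma>2 - 2 *\<^sub>R ?V"
    by (subst B) (simp add: matrix_vector_mult_diff_distrib matrix_vector_mult_scaleR)
  then show ?thesis by (simp add: matrix_vector_mul_assoc)
qed

text \<open>
  A common solution of the two systems satisfies \<open>R S S\<^sup>T z = 0\<close>. For \<open>R \<noteq> 0\<close> this means \<open>z = 0\<close>, and
  then \<open>K\<^sup>2 g = 0\<close>.
\<close>

lemma efforts_agree_iff_risk_neutral:
  fixes K S :: "real^'n^'n"
  assumes K: "invertible K" and S: "invertible S" and g: "g \<noteq> 0"
    and comp: "K *v (K *v b) + (2 * R) *\<^sub>R (S *v (transpose S *v b)) = K *v (K *v g)"
    and aggr: "K *v (K *v z) + R *\<^sub>R (S *v (transpose S *v z)) = K *v (K *v g)"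
  shows "K *v b = K *v z \<longleftrightarrow> R = 0"
proof
  have inj: "x = y" if "A *v x = A *v y" "invertible A" for A :: "real^'n^'n" and x y
    using that inj_matrix_vector_mult by (blast dest: injD)
  assume "K *v b = K *v z"
  then have bz: "b = z" using inj K by blast
  show "R = 0"
  proof (rule ccontr)
    assume R: "R \<noteq> 0"
    have "(2 * R) *\<^sub>R (S *v (transpose S *v z)) = R *\<^sub>R (S *v (transpose S *v z))"
      using comp aggr by (metis add_left_cancel bz)
    then have "S *v (transpose S *v z) = S *v (transpose S *v 0)"
      using R by simp
    then have "z = 0" using inj S transpose_invertible by blast
    then have "K *v (K *v g) = K *v (K *v 0)" using aggr by simp
    then have "g = 0" using inj K by blast
    with g show False by simp
  qed
next
  assume "R = 0"
  then have "K *v (K *v b) = K *v (K *v z)" using comp aggr by simp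
  then show "K *v b = K *v z" using inj_matrix_vector_mult[OF K] by (blast dest: injD)
qed

theorem proposition5p2:
  fixes M :: "'a measure" and F :: "real \<Rightarrow> 'a measure" and W :: "real \<Rightarrow> 'a \<Rightarrow> real^2"
    and T Y0 R\<^sub>A k1 k2 \<gamma>1 \<gamma>2 :: real and x0 \<beta>1 \<beta>2 :: "real^2" and K S :: "real^2^2"
    and Z :: "real \<Rightarrow> 'a \<Rightarrow> real^2"
  assumes "T > 0"
    and "R\<^sub>A \<ge> 0"
    and "\<gamma>1 \<in> {0..1}" and "\<gamma>2 \<in> {0..1}"
    and "invertible S"
    and "K = diag2 k1 k2" and "invertible K"
    and "brownian_motion M F W"
    and "nash_equilibrium R\<^sub>A K S \<gamma>1 \<gamma>2 \<beta>1 \<beta>2"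
    and "aggregated_optimal M F W T x0 Y0 R\<^sub>A K S \<gamma>1 \<gamma>2 Z"
  shows "(AE (t, \<omega>) in time_space T M.
            competitive_effort K \<beta>1 \<beta>2 = aggregated_effort K Z t \<omega>) \<longleftrightarrow> R\<^sub>A = 0"
proof -
  note T = assms(1) and R = assms(2) and K = assms(7) and bm = assms(8)
  have sym: "transpose K = K"
    using assms(6) by (simp add: diag2_def transpose_def vec_eq_iff forall_2)
  have g: "Gam \<gamma>1 \<gamma>2 \<noteq> 0"
  proof
    assume "Gam \<gamma>1 \<gamma>2 = 0"
    \<comment> \<open>The two entries of \<open>\<Gamma>\<close> always add up to 2.\<close>
    then have "Gam \<gamma>1 \<gamma>2 $ 1 + Gam \<gamma>1 \<gamma>2 $ 2 = 0" by simp
    then show False by (simp add: Gam_def)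
  qed
  obtain z0 where z0: "K *v (K *v z0) + R\<^sub>A *\<^sub>R (S *v (transpose S *v z0)) = K *v (K *v Gam \<gamma>1 \<gamma>2)"
    using first_order_condition_solvable[OF sym K R] by blast
  have aggr: "AE p in time_space T M. (case p of (t, \<omega>) \<Rightarrow> aggregated_effort K Z t \<omega>) = K *v z0"
    using aggregated_optimal_effort[OF bm T R sym z0 assms(10)] by (simp add: case_prod_beta')
  have M: "prob_space M" using bm by (simp add: brownian_motion_def)
  \<comment> \<open>Because \<open>T > 0\<close>, an almost everywhere statement about constants is true outright.\<close>
  have nonnull: "emeasure (time_space T M) (space (time_space T M)) \<noteq> 0"
    using time_space_finite(1)[OF M, of T] T by simp
  have "(AE (t, \<omega>) in time_space T M. competitive_effort K \<beta>1 \<beta>2 = aggregated_effort K Z t \<omega>)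
      \<longleftrightarrow> (AE p in time_space T M. K *v (\<beta>1 + \<beta>2) = K *v z0)"
  proof
    assume "AE (t, \<omega>) in time_space T M. competitive_effort K \<beta>1 \<beta>2 = aggregated_effort K Z t \<omega>"
    with aggr show "AE p in time_space T M. K *v (\<beta>1 + \<beta>2) = K *v z0"
      by eventually_elim (auto simp: competitive_effort_def best_response_def)
  next
    assume "AE p in time_space T M. K *v (\<beta>1 + \<beta>2) = K *v z0"
    with aggr show "AE (t, \<omega>) in time_space T M. competitive_effort K \<beta>1 \<beta>2 = aggregated_effort K Z t \<omega>"
      by eventually_elim (auto simp: competitive_effort_def best_response_def)
  qed
  also have "\<dots> \<longleftrightarrow> K *v (\<beta>1 + \<beta>2) = K *v z0"
    using nonnull by (simp add: eventually_const_iff ae_filter_eq_bot_iff)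
  also have "\<dots> \<longleftrightarrow> R\<^sub>A = 0"
    by (rule efforts_agree_iff_risk_neutral[OF K assms(5) g
          nash_equilibrium_total_sensitivity[OF K assms(9)] z0])
  finally show ?thesis .
qed

end
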